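(* Let $\mathbb{F}$ be a finite field, let $n\ge 1$, and let $\mathcal{C}$ be nonzero and either an $\mathbb{F}[z,z^{-1}]$-submodule of $\mathbb{F}^n[z,z^{-1}]$ or an $\mathbb{F}[z]$-submodule of $\mathbb{F}^n[z]$. Regard $\mathcal{C}$ as a subset of $\mathbb{F}^n[[z,z^{-1}]]$. Then $\mathcal{C}$ is controllable and is not complete.
   Context: $\mathbb{F}^n[[z,z^{-1}]]$ denotes the set of all formal two-sided series $w(z)=\sum_{i=-\infty}^{\infty}w_iz^i$ with $w_i\in\mathbb{F}^n$, identified with the two-sided sequence space $(\mathbb{F}^n)^{\mathbb{Z}}$. $\mathbb{F}^n[z]$ and $\mathbb{F}^n[z,z^{-1}]$ are the sets of $n$-vectors with polynomial, respectively Laurent polynomial, entries, viewed as subsets of $\mathbb{F}^n[[z,z^{-1}]]$. For $w=\sum_{i}w_iz^i$ write $w^+=\sum_{i\ge 0}w_iz^i$ and $w^-=\sum_{i\le 0}w_iz^i$. A subset $\mathcal{B}\subset\mathbb{F}^n[[z,z^{-1}]]$ is called controllable if there is some integer $\ell$ (of either sign) such that for every $w,w'\in\mathcal{B}$ and every integer $j$ there exists $w''\in\mathcal{B}$ with $(z^jw'')^-=(z^jw)^-$ and $(z^{j+\ell}w'')^+=(z^{j+\ell}w')^+$. A subset $\mathcal{B}\subset\mathbb{F}^n[[z,z^{-1}]]$ is called complete if every $w\in\mathbb{F}^n[[z,z^{-1}]]$ such that $w|_J\in\mathcal{B}|_J$ for every finite subinterval $J\subset\mathbb{Z}$ belongs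 to $\mathcal{B}$. Here $w|_J=(w_i)_{i\in J}$ and $\mathcal{B}|_J=\{v|_J\mid v\in\mathcal{B}\}$. *)

theory Defs
  imports
    "HOL-Analysis.Analysis"
    "HOL-Computational_Algebra.Polynomial"
    "HOL-Library.Poly_Mapping"
begin

text \<open>The formal two-sided series \<open>\<Sum>i. w\<^sub>i z\<^sup>i\<close> with coefficients in \<open>F\<^sup>n\<close> is the function \<open>i \<mapsto> w\<^sub>i\<close>.\<close>

type_synonym ('a, 'n) series = "int \<Rightarrow> 'a ^ 'n"

definition zshift :: "int \<Rightarrow> ('a, 'n) series \<Rightarrow> ('a, 'n) series"  \<comment> \<open>\<open>z\<^sup>j w\<close>\<close>
  where "zshift j w = (\<lambda>i. w (i - j))"

text \<open>Both truncations keep the coefficient at index 0.\<close>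

definition plus_part :: "('a::zero, 'n::finite) series \<Rightarrow> ('a, 'n) series"
  where "plus_part w = (\<lambda>i. if i \<ge> 0 then w i else 0)"

definition minus_part :: "('a::zero, 'n::finite) series \<Rightarrow> ('a, 'n) series"
  where "minus_part w = (\<lambda>i. if i \<le> 0 then w i else 0)"

definition controllable :: "('a::zero, 'n::finite) series set \<Rightarrow> bool"
  where "controllable B \<longleftrightarrow>
    (\<exists>l::int. \<forall>w\<in>B. \<forall>w'\<in>B. \<forall>j::int. \<exists>w''\<in>B.
      minus_part (zshift j w'') = minus_part (zshift j w) \<and>
      plus_part (zshift (j + l) w'') = plus_part (zshift (j + l) w'))"

text \<open>Not to be confused with \<^const>\<open>complete\<close> for metric spaces. The finite subintervals of the
  integers are the sets \<open>{a..b}\<close>; the empty one occurs for \<open>a > b\<close>.\<close>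

definition complete_series_set :: "('a, 'n) series set \<Rightarrow> bool"
  where "complete_series_set B \<longleftrightarrow>
    (\<forall>w. (\<forall>a b::int. restrict w {a..b} \<in> (\<lambda>v. restrict v {a..b}) ` B) \<longrightarrow> w \<in> B)"

text \<open>The ring of Laurent polynomials over \<open>F\<close> is the group ring of the integers: finitely supported
  functions with the convolution product, as provided by \<^type>\<open>poly_mapping\<close>.\<close>

type_synonym 'a laurent_poly = "int \<Rightarrow>\<^sub>0 'a"

definition series_of_laurent :: "('a::zero laurent_poly) ^ 'n \<Rightarrow> ('a, 'n::finite) series"
  where "series_of_laurent p = (\<lambda>i. \<chi> k. Poly_Mapping.lookup (p $ k) i)"

definition series_of_poly :: "('a::zero poly) ^ 'n \<Rightarrow> ('a, 'n::finite) series"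
  where "series_of_poly p = (\<lambda>i. \<chi> k. if i \<ge> 0 then poly.coeff (p $ k) (nat i) else 0)"

text \<open>Both coefficient rings used below are commutative, so \<open>module.subspace (*s)\<close>
  expresses being a submodule of the free module of \<open>n\<close>-vectors.\<close>

lemma module_vector_scalar_mult:
  "module ((*s) :: 'r::comm_ring_1 \<Rightarrow> 'r ^ 'n::finite \<Rightarrow> 'r ^ 'n)"
  by unfold_locales (simp_all add: vec_eq_iff algebra_simps)

definition laurent_submodule :: "(('a::field laurent_poly) ^ 'n::finite) set \<Rightarrow> bool"
  where "laurent_submodule M \<longleftrightarrow> module.subspace (*s) M"

definition poly_submodule :: "(('a::field poly) ^ 'n::finite) set \<Rightarrow> bool"
  where "poly_submodule M \<longleftrightarrow> module.subspace (*s) M"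

end

theory Submission
  imports Defs
begin

text \<open>Both kinds of module consist of sequences of bounded support and are closed under differences
  and under delays \<open>z\<^sup>k\<close> with \<open>k \<ge> 0\<close>; this is all that the argument uses, together with the
  dichotomy that either all supports start at index \<open>0\<close> or later, or all shifts are allowed.

  Controllability asks for a uniform bound \<open>L\<close> such that a past \<open>w\<close> can be connected to a future
  \<open>w'\<close> within \<open>L\<close> time steps. By linearity it suffices to connect the past of \<open>v = w - w'\<close>
  to the zero future. Since \<open>F\<^sup>n\<close> is finite, only finitely many vectors occur as leading
  coefficients, so one bound \<open>D\<close> serves for representatives of all of them: every leading coefficient
  of an element \<open>v\<close>, at index \<open>d\<close>, is the leading coefficient of an element supported in
  \<open>{d-D..d}\<close> (\<open>leading_coeff_local\<close>). Subtracting these elements one after the other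
  removes the coefficients of \<open>v\<close> from the top down to any prescribed index, and disturbs only
  the \<open>D\<close> coefficients below it (\<open>truncation\<close>). This replaces the usual appeal to finite generation.

  Completeness fails because the infinitely many translates of a nonzero element to the right, spaced
  so that their supports are disjoint, add up to a sequence of unbounded support, whereas on every
  finite interval this sequence agrees with a finite partial sum, which lies in the module.\<close>

section \<open>Shift-closed groups of sequences with bounded support\<close>

locale finite_support_module =
  fixes C :: "('a::{field, finite}, 'n::finite) series set"
  assumes zero_mem: "(\<lambda>i. 0) \<in> C"
    and diff_mem: "v \<in> C \<Longrightarrow> w \<in> C \<Longrightarrow> (\<lambda>i. v i - w i) \<in> C"
    and delay_mem: "v \<in> C \<Longrightarrow> k \<ge> 0 \<Longrightarrow> zshift k v \<in> C"
    and bounded_support: "v \<in> C \<Longrightarrow> \<exists>N. \<forall>i. \<bar>i\<bar> > N \<longrightarrow> v i = 0"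
    and one_sided_or_shift_invariant:
      "(\<forall>v\<in>C. \<forall>i<0. v i = 0) \<or> (\<forall>v\<in>C. \<forall>k. zshift k v \<in> C)"
begin

lemma add_mem:
  assumes "v \<in> C" "w \<in> C"
  shows "(\<lambda>i. v i + w i) \<in> C"
  using diff_mem[OF assms(1) diff_mem[OF zero_mem assms(2)]] by simp

text \<open>Choose one representative for each of the finitely many vectors that are leading coefficients
  of elements supported in the nonnegative indices, and let \<open>D\<close> bound their degrees. A leading
  coefficient at an index \<open>d > D\<close> is matched by delaying its representative; for \<open>d \<le> D\<close> the element
  itself is already short enough. In the shift-invariant case any element can first be moved to the
  nonnegative indices.\<close>

lemma leading_coeff_local:
  obtains D :: int where "D \<ge> 0"
    and "\<And>v d. v \<in> C \<Longrightarrow> \<forall>i>d. v i = 0 \<Longrightarrow>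
           \<exists>g\<in>C. g d = v d \<and> (\<forall>i. i < d - D \<or> d < i \<longrightarrow> g i = 0)"
proof -
  define R where "R c e \<longleftrightarrow> (\<exists>g\<in>C. (\<forall>i. i < 0 \<or> e < i \<longrightarrow> g i = 0) \<and> g e = c)"
    for c :: "'a ^ 'n" and e :: int
  define f where "f c = (SOME e. R c e)" for c
  have f: "R c (f c)" if "R c e" for c e
    unfolding f_def using that by (rule someI)
  define D where "D = Max (insert 0 (range f))"
  have D0: "D \<ge> 0" and fD: "f c \<le> D" for c
    unfolding D_def by (rule Max_ge; simp)+
  have nonneg: "\<exists>g\<in>C. g d = v d \<and> (\<forall>i. i < d - D \<or> d < i \<longrightarrow> g i = 0)"
    if v: "v \<in> C" "\<forall>i<0. v i = 0" and top: "\<forall>i>d. v i = 0" for v d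
  proof (cases "d \<le> D")
    case True
    then show ?thesis using v top by (intro bexI[of _ v]) auto
  next
    case False
    have "R (v d) d" unfolding R_def using v top by (intro bexI[of _ v]) auto
    then have "R (v d) (f (v d))" by (rule f)
    then obtain g where g: "g \<in> C" "\<And>i. i < 0 \<or> f (v d) < i \<Longrightarrow> g i = 0" "g (f (v d)) = v d"
      unfolding R_def by blast
    have "zshift (d - f (v d)) g \<in> C"
      using g(1) False fD[of "v d"] by (intro delay_mem) auto
    moreover have "zshift (d - f (v d)) g d = v d"
      using g(3) by (simp add: zshift_def)
    moreover have "zshift (d - f (v d)) g i = 0" if "i < d - D \<or> d < i" for i
      unfolding zshift_def using that fD[of "v d"] by (intro g(2)) auto
    ultimately show ?thesis by blast
  qed
  have "\<exists>g\<in>C. g d = v d \<and> (\<forall>i. i < d - D \<or> d < i \<longrightarrow> g i = 0)"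
    if v: "v \<in> C" and top: "\<forall>i>d. v i = 0" for v d
    using one_sided_or_shift_invariant
  proof
    assume "\<forall>v\<in>C. \<forall>i<0. v i = 0"
    then show ?thesis using nonneg v top by blast
  next
    assume shift: "\<forall>v\<in>C. \<forall>k. zshift k v \<in> C"
    obtain N where N: "\<And>i. \<bar>i\<bar> > N \<Longrightarrow> v i = 0" using bounded_support[OF v] by blast
    have "\<forall>i<0. zshift N v i = 0" "\<forall>i>d+N. zshift N v i = 0"
      using N top by (auto simp: zshift_def)
    then obtain g where g: "g \<in> C" "g (d + N) = zshift N v (d + N)"
        "\<And>i. i < d + N - D \<or> d + N < i \<Longrightarrow> g i = 0"
      using nonneg[of "zshift N v" "d + N"] shift v by blast
    have "zshift (- N) g \<in> C" using shift g(1) by blast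
    moreover have "zshift (- N) g d = v d" using g(2) by (simp add: zshift_def)
    moreover have "zshift (- N) g i = 0" if "i < d - D \<or> d < i" for i
      unfolding zshift_def using that by (intro g(3)) auto
    ultimately show ?thesis by blast
  qed
  then show thesis using that D0 by blast
qed

text \<open>Cancelling the top coefficient at \<open>d \<ge> m + L\<close> alters only indices \<open>\<ge> d - D\<close>, and
  \<open>d - D > m\<close> for \<open>L = D + 1\<close>. The induction is on the number of indices from \<open>m + L\<close> on that may
  still carry a nonzero coefficient.\<close>

lemma truncation:
  obtains L :: int
  where "\<And>v m. v \<in> C \<Longrightarrow> \<exists>u\<in>C. (\<forall>i\<le>m. u i = v i) \<and> (\<forall>i\<ge>m + L. u i = 0)"
proof -
  obtain D where D: "D \<ge> 0"
    and local: "\<And>v d. v \<in> C \<Longrightarrow> \<forall>i>d. v i = 0 \<Longrightarrow>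
           \<exists>g\<in>C. g d = v d \<and> (\<forall>i. i < d - D \<or> d < i \<longrightarrow> g i = 0)"
    using leading_coeff_local by metis
  define L where "L = D + 1"
  have *: "\<exists>u\<in>C. (\<forall>i\<le>m. u i = v i) \<and> (\<forall>i\<ge>m + L. u i = 0)"
    if "v \<in> C" "\<forall>i\<ge>m + L + int k. v i = 0" for v m k
    using that
  proof (induction k arbitrary: v)
    case 0
    then show ?case by auto
  next
    case (Suc k)
    define d where "d = m + L + int k"
    have "\<forall>i>d. v i = 0" using Suc.prems(2) by (auto simp: d_def)
    then obtain g where g: "g \<in> C" "g d = v d" "\<And>i. i < d - D \<or> d < i \<Longrightarrow> g i = 0"
      using local[OF Suc.prems(1)] by blast
    have "v i - g i = 0" if "i \<ge> d" for i
      using that g(2) g(3)[of i] \<open>\<forall>i>d. v i = 0\<close> by (cases "i = d") auto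
    then obtain u where u: "u \<in> C" "\<forall>i\<le>m. u i = v i - g i" "\<forall>i\<ge>m + L. u i = 0"
      using Suc.IH[OF diff_mem[OF Suc.prems(1) g(1)]] by (auto simp: d_def)
    moreover have "g i = 0" if "i \<le> m" for i
      using that by (intro g(3)) (auto simp: d_def L_def)
    ultimately show ?case by auto
  qed
  have "\<exists>u\<in>C. (\<forall>i\<le>m. u i = v i) \<and> (\<forall>i\<ge>m + L. u i = 0)" if v: "v \<in> C" for v m
  proof -
    obtain N where N: "\<And>i. \<bar>i\<bar> > N \<Longrightarrow> v i = 0" using bounded_support[OF v] by blast
    show ?thesis
      by (rule *[OF v, of _ "nat (N + 1 - m - L)"]) (auto intro!: N)
  qed
  then show thesis by (rule that)
qed

text \<open>In \<^const>\<open>controllable\<close> the past ends at index \<open>-j\<close> and the future starts at \<open>-j - l\<close>, so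
  that a delay of \<open>L\<close> steps means \<open>l = -L\<close>.\<close>

lemma controllable: "controllable C"
proof -
  obtain L :: int where L:
    "\<And>v m. v \<in> C \<Longrightarrow> \<exists>u\<in>C. (\<forall>i\<le>m. u i = v i) \<and> (\<forall>i\<ge>m + L. u i = 0)"
    using truncation by metis
  show ?thesis unfolding controllable_def
  proof (intro exI[of _ "- L"] ballI allI)
    fix w w' and j :: int
    assume w: "w \<in> C" "w' \<in> C"
    obtain u where u: "u \<in> C" "\<And>i. i \<le> - j \<Longrightarrow> u i = w i - w' i" "\<And>i. i \<ge> - j + L \<Longrightarrow> u i = 0"
      using L[OF diff_mem[OF w], of "- j"] by blast
    show "\<exists>w''\<in>C. minus_part (zshift j w'') = minus_part (zshift j w) \<and>
            plus_part (zshift (j + - L) w'') = plus_part (zshift (j + - L) w')"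
      using add_mem[OF u(1) w(2)] u(2,3)
      by (intro bexI[of _ "\<lambda>i. u i + w' i"])
         (auto simp: minus_part_def plus_part_def zshift_def fun_eq_iff)
  qed
qed

text \<open>If \<open>g\<close> is supported in \<open>{-N..N}\<close>, its translates by multiples of the period \<open>P = 2N+1\<close> have
  disjoint supports, so their sum can be written down without summation: reduce the index
  modulo \<open>P\<close> into \<open>{-N..N}\<close>.\<close>

lemma not_complete:
  assumes "C \<noteq> {\<lambda>i. 0}"
  shows "\<not> complete_series_set C"
proof
  assume complete: "complete_series_set C"
  obtain g where g: "g \<in> C" "g \<noteq> (\<lambda>i. 0)" using assms zero_mem by blast
  obtain i0 where i0: "g i0 \<noteq> 0" using g(2) by auto
  obtain N where N: "\<And>i. \<bar>i\<bar> > N \<Longrightarrow> g i = 0" using bounded_support[OF g(1)] by blast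
  have i0N: "\<bar>i0\<bar> \<le> N" using N i0 not_le by blast
  define P where "P = 2 * N + 1"
  have P: "P > 0" using i0N by (auto simp: P_def)
  have le_mult: "int k \<le> int k * P" for k
    using P mult_left_mono[of 1 P "int k"] by simp
  define w where "w i = (if i \<ge> - N then g ((i + N) mod P - N) else 0)" for i
  \<comment> \<open>the sum of the first \<open>k\<close> translates\<close>
  define s where "s k i = (if i + N < int k * P then w i else 0)" for k i
  \<comment> \<open>on its \<open>k\<close>-th period, \<open>w\<close> coincides with the translate of \<open>g\<close> by \<open>k P\<close>\<close>
  have copy: "w i = g (i - int k * P)" if "int k * P \<le> i + N" "i + N < int (Suc k) * P" for i k
  proof -
    have "(i + N) mod P = (i + N - int k * P) mod P"
      by (metis mod_mult_self2 diff_add_cancel mult.commute)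
    also have "\<dots> = i + N - int k * P"
      using that by (intro mod_pos_pos_trivial) (auto simp: algebra_simps)
    finally have "(i + N) mod P - N = i - int k * P" by simp
    moreover have "0 \<le> int k * P" using P by simp
    ultimately show ?thesis using that(1) by (simp add: w_def)
  qed
  have s_mem: "s k \<in> C" for k
  proof (induction k)
    case 0
    have "s 0 = (\<lambda>i. 0)" by (auto simp: s_def w_def)
    then show ?case using zero_mem by simp
  next
    case (Suc k)
    have "s (Suc k) i = s k i + zshift (int k * P) g i" for i
    proof (cases "int k * P \<le> i + N \<and> i + N < int (Suc k) * P")
      case True
      then show ?thesis using copy[of k i] by (simp add: s_def zshift_def)
    next
      case False
      then have "zshift (int k * P) g i = 0"
        unfolding zshift_def by (intro N) (auto simp: P_def algebra_simps)
      then show ?thesis using False P by (auto simp: s_def algebra_simps)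
    qed
    then have "s (Suc k) = (\<lambda>i. s k i + zshift (int k * P) g i)" by auto
    moreover have "zshift (int k * P) g \<in> C" using P by (intro delay_mem g(1)) simp
    ultimately show ?case using add_mem Suc.IH by simp
  qed
  have "restrict w {a..b} \<in> (\<lambda>v. restrict v {a..b}) ` C" for a b
  proof (rule image_eqI)
    have "b + N < int (nat (b + N + 1)) * P"
      using le_mult[of "nat (b + N + 1)"] by linarith
    then show "restrict w {a..b} = restrict (s (nat (b + N + 1))) {a..b}"
      by (auto simp: restrict_def s_def fun_eq_iff)
  qed (rule s_mem)
  then have "w \<in> C"
    by (intro complete[unfolded complete_series_set_def, rule_format])
  then obtain K where K: "\<And>i. \<bar>i\<bar> > K \<Longrightarrow> w i = 0" using bounded_support by blast
  define k where "k = nat (\<bar>K\<bar> + \<bar>i0\<bar> + 1)"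
  have "w (i0 + int k * P) = g i0"
    using copy[of k "i0 + int k * P"] i0N by (simp add: P_def algebra_simps)
  moreover have "\<bar>i0 + int k * P\<bar> > K"
    using le_mult[of k] unfolding k_def by linarith
  ultimately show False using K i0 by metis
qed

end

section \<open>Laurent polynomial and polynomial modules as sequence spaces\<close>

lemma lookup_single_one_mult:
  fixes p :: "'a::comm_ring_1 laurent_poly"
  shows "Poly_Mapping.lookup (Poly_Mapping.single k 1 * p) i = Poly_Mapping.lookup p (i - k)"
proof -
  have index: "i = l + q \<longleftrightarrow> q = i - l" for l q by auto
  show ?thesis
    by (simp add: lookup_mult lookup_single index when_mult)
qed

lemma finite_support_module_laurent:
  fixes M :: "('a::{field, finite} laurent_poly ^ 'n::finite) set"
  assumes "laurent_submodule M"
  shows "finite_support_module (series_of_laurent ` M)"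
proof -
  interpret module "(*s) :: 'a laurent_poly \<Rightarrow> 'a laurent_poly ^ 'n \<Rightarrow> 'a laurent_poly ^ 'n"
    by (rule module_vector_scalar_mult)
  have M: "subspace M" using assms by (simp add: laurent_submodule_def)
  have shift: "zshift k (series_of_laurent p) \<in> series_of_laurent ` M" if "p \<in> M" for p k
  proof (rule image_eqI)
    show "zshift k (series_of_laurent p) = series_of_laurent (Poly_Mapping.single k 1 *s p)"
      by (simp add: zshift_def series_of_laurent_def lookup_single_one_mult)
  qed (use M that in \<open>rule subspace_scale\<close>)
  show ?thesis
  proof
    show "(\<lambda>i. 0) \<in> series_of_laurent ` M"
      by (rule image_eqI[OF _ subspace_0[OF M]]) (simp add: series_of_laurent_def vec_eq_iff fun_eq_iff)
  next
    fix v w assume "v \<in> series_of_laurent ` M" "w \<in> series_of_laurent ` M"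
    then obtain p q where "v = series_of_laurent p" "p \<in> M" "w = series_of_laurent q" "q \<in> M" by blast
    then show "(\<lambda>i. v i - w i) \<in> series_of_laurent ` M"
      by (intro image_eqI[of _ _ "p - q"] subspace_diff[OF M])
         (simp_all add: series_of_laurent_def vec_eq_iff fun_eq_iff lookup_minus)
  next
    fix v assume "v \<in> series_of_laurent ` M"
    then obtain p where v: "v = series_of_laurent p" by blast
    define S where "S = abs ` (\<Union>k. Poly_Mapping.keys (p $ k))"
    have "finite S" by (simp add: S_def)
    have "v i = 0" if "\<bar>i\<bar> > Max S" for i
    proof -
      have "\<bar>i\<bar> \<notin> S" using that \<open>finite S\<close> Max_ge not_le by blast
      then have "i \<notin> Poly_Mapping.keys (p $ k)" for k unfolding S_def by blast
      then show ?thesis by (simp add: v series_of_laurent_def vec_eq_iff in_keys_iff)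
    qed
    then show "\<exists>N. \<forall>i. \<bar>i\<bar> > N \<longrightarrow> v i = 0" by blast
  qed (use shift in auto)
qed

lemma finite_support_module_poly:
  fixes M :: "('a::{field, finite} poly ^ 'n::finite) set"
  assumes "poly_submodule M"
  shows "finite_support_module (series_of_poly ` M)"
proof -
  interpret module "(*s) :: 'a poly \<Rightarrow> 'a poly ^ 'n \<Rightarrow> 'a poly ^ 'n"
    by (rule module_vector_scalar_mult)
  have M: "subspace M" using assms by (simp add: poly_submodule_def)
  show ?thesis
  proof
    show "(\<lambda>i. 0) \<in> series_of_poly ` M"
      by (rule image_eqI[OF _ subspace_0[OF M]]) (simp add: series_of_poly_def vec_eq_iff fun_eq_iff)
  next
    fix v w assume "v \<in> series_of_poly ` M" "w \<in> series_of_poly ` M"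
    then obtain p q where "v = series_of_poly p" "p \<in> M" "w = series_of_poly q" "q \<in> M" by blast
    then show "(\<lambda>i. v i - w i) \<in> series_of_poly ` M"
      by (intro image_eqI[of _ _ "p - q"] subspace_diff[OF M])
         (simp_all add: series_of_poly_def vec_eq_iff fun_eq_iff)
  next
    fix v and k :: int assume "v \<in> series_of_poly ` M" "k \<ge> 0"
    then obtain p where p: "v = series_of_poly p" "p \<in> M" by blast
    show "zshift k v \<in> series_of_poly ` M"
    proof (rule image_eqI)
      show "zshift k v = series_of_poly (monom 1 (nat k) *s p)"
        using \<open>k \<ge> 0\<close>
        by (auto simp: p zshift_def series_of_poly_def vec_eq_iff fun_eq_iff coeff_monom_mult
              nat_diff_distrib nat_le_iff)
    qed (use M p in \<open>auto intro: subspace_scale\<close>)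
  next
    fix v assume "v \<in> series_of_poly ` M"
    then obtain p where v: "v = series_of_poly p" by blast
    define B where "B = Max (range (\<lambda>k. degree (p $ k)))"
    have "degree (p $ k) \<le> B" for k by (simp add: B_def)
    then have "poly.coeff (p $ k) m = 0" if "m > B" for k m
      using that by (meson coeff_eq_0 le_less_trans)
    then have "v i = 0" if "\<bar>i\<bar> > int B" for i
      using that by (simp add: v series_of_poly_def vec_eq_iff)
    then show "\<exists>N. \<forall>i. \<bar>i\<bar> > N \<longrightarrow> v i = 0" by blast
  qed (auto simp: series_of_poly_def vec_eq_iff)
qed

theorem theorem5p3:
  fixes C :: "('a::{field, finite}, 'n::finite) series set"
  assumes submodule:
      "(\<exists>M :: ('a laurent_poly ^ 'n) set. laurent_submodule M \<and> C = series_of_laurent ` M) \<or>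
       (\<exists>M :: ('a poly ^ 'n) set. poly_submodule M \<and> C = series_of_poly ` M)"
    and nonzero: "C \<noteq> {\<lambda>i. 0}"
  shows "controllable C \<and> \<not> complete_series_set C"
proof -
  have "finite_support_module C"
    using submodule finite_support_module_laurent finite_support_module_poly by blast
  then show ?thesis
    using nonzero finite_support_module.controllable finite_support_module.not_complete by blast
qed

end
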